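(* Let $X$ be a complete metric space and let $E$ and $F$ be Banach spaces. Given a function $\Xi:X\times E\to F$, associate with it a mapping $S$ by $Sf(x)=\Xi(x,f(x))$ for functions $f:X\to E$. Then $S$ maps $U(X,E)$ into $U(X,F)$ if and only if $\Xi$ is continuous at all $(x_0,e_0)\in X'\times E$ and $\Xi$ is $u$-continuous.
   Context: $U(X,E)$ is the space of uniformly continuous functions $X\to E$; $X'$ is the set of accumulation points of $X$. A sequence $(x_n)$ in $X$ is separated if $\inf_{n\neq m}d(x_n,x_m)>0$. For $\varepsilon>0$ define $d_\varepsilon:X\times X\to[0,\infty]$ by $$d_\varepsilon(a,b)=\inf\Big\{\sum_{i=1}^n d(x_{i-1},x_i): n\in\mathbb{N},\ x_0=a,\ x_n=b,\ d(x_{i-1},x_i)\le\varepsilon\text{ for all }i\Big\},\quad \inf\emptyset=\infty.$$ A sequence $((x_n,e_n))_{n=1}^\infty$ in $X\times E$ is a $u$-sequence if $(x_n)$ is separated and there are $\varepsilon>0$ and $C<\infty$ with $\|e_n-e_m\|\le C\,d_\varepsilon(x_n,x_m)$ for all $m,n\in\mathbb{N}$. $\Xi$ is $u$-continuous if for every $u$-sequence $((x_n,e_n))$ and every sequence $((x_n',e_n'))$ in $X\times E$ with $x_n\neq x_n'$ for all $n$ and $\lim(d(x_n,x_n')+\|e_n-e_n'\|)=0$, one has $\lim\|\Xi(x_n,e_n)-\Xi(x_n',e_n')\|=0$. *)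

theory Defs
  imports "HOL-Analysis.Analysis"
begin

definition unif_cont_funs :: "('a::metric_space \<Rightarrow> 'b::metric_space) set" where
  "unif_cont_funs = {f. uniformly_continuous_on UNIV f}"

definition accumulation_points :: "'a::topological_space set" where
  "accumulation_points = {x. x islimpt UNIV}"

definition superposition :: "('a \<times> 'b \<Rightarrow> 'c) \<Rightarrow> ('a \<Rightarrow> 'b) \<Rightarrow> 'a \<Rightarrow> 'c" where
  "superposition \<Xi> f = (\<lambda>x. \<Xi> (x, f x))"

definition separated_seq :: "(nat \<Rightarrow> 'a::metric_space) \<Rightarrow> bool" where
  "separated_seq x \<longleftrightarrow> (INF (n, m) \<in> {(n, m). n \<noteq> m}. dist (x n) (x m)) > 0"

definition chains :: "real \<Rightarrow> 'a::metric_space \<Rightarrow> 'a \<Rightarrow> (nat \<times> (nat \<Rightarrow> 'a)) set" where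
  "chains \<epsilon> a b =
     {(n, x). 1 \<le> n \<and> x 0 = a \<and> x n = b \<and> (\<forall>i\<in>{1..n}. dist (x (i - 1)) (x i) \<le> \<epsilon>)}"

(* The infimum is taken in ennreal, so it is \<infinity> when no \<epsilon>-chain joins a to b. *)
definition chain_dist :: "real \<Rightarrow> 'a::metric_space \<Rightarrow> 'a \<Rightarrow> ennreal" where
  "chain_dist \<epsilon> a b =
     (INF (n, x) \<in> chains \<epsilon> a b. ennreal (\<Sum>i=1..n. dist (x (i - 1)) (x i)))"

(* Here 0 * \<infinity> = 0 in ennreal; since C may always be enlarged, the notion does not
   depend on this convention. *)
definition u_sequence ::
    "(nat \<Rightarrow> 'a::metric_space \<times> 'b::real_normed_vector) \<Rightarrow> bool" where
  "u_sequence s \<longleftrightarrow>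
     separated_seq (\<lambda>n. fst (s n)) \<and>
     (\<exists>\<epsilon>>0. \<exists>C<\<infinity>. \<forall>m n.
        ennreal (norm (snd (s n) - snd (s m))) \<le> C * chain_dist \<epsilon> (fst (s n)) (fst (s m)))"

definition u_continuous ::
    "('a::metric_space \<times> 'b::real_normed_vector \<Rightarrow> 'c::real_normed_vector) \<Rightarrow> bool" where
  "u_continuous \<Xi> \<longleftrightarrow>
     (\<forall>s s'. u_sequence s \<longrightarrow>
        (\<forall>n. fst (s n) \<noteq> fst (s' n)) \<longrightarrow>
        (\<lambda>n. dist (fst (s n)) (fst (s' n)) + norm (snd (s n) - snd (s' n))) \<longlonglongrightarrow> 0 \<longrightarrow>
        (\<lambda>n. norm (\<Xi> (s n) - \<Xi> (s' n))) \<longlonglongrightarrow> 0)"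

end

theory Submission
  imports Defs
begin

text \<open>
  Sufficiency. If \<open>Sf\<close> is not uniformly continuous although \<open>f\<close> is, there are points
  \<open>x\<^sub>n, y\<^sub>n\<close> with \<open>d(x\<^sub>n, y\<^sub>n) \<rightarrow> 0\<close> whose images under \<open>Sf\<close> stay apart; in particular
  \<open>x\<^sub>n \<noteq> y\<^sub>n\<close>. By completeness, a subsequence of \<open>(x\<^sub>n)\<close> either converges or is separated
  (\<open>convergent_or_separated_subseq\<close>). In the first case the limit is an accumulation point, because
  \<open>x\<^sub>n \<noteq> y\<^sub>n\<close>, and continuity of \<open>\<Xi>\<close> there gives a contradiction. In the second case the pairs
  \<open>(x\<^sub>n, f(x\<^sub>n))\<close> form a u-sequence, since a uniformly continuous function is Lipschitz at large scale
  for the chain distance \<open>d\<^sub>\<epsilon>\<close> (\<open>u_sequence_graph\<close>), and u-continuity gives a contradiction.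

  Necessity. Bad behaviour of \<open>\<Xi>\<close> along some sequence of pairs contradicts the hypothesis as soon as a
  uniformly continuous \<open>f\<close> takes the prescribed values along a subsequence. All such \<open>f\<close> are sums of
  bumps with disjoint supports, and such a sum is uniformly continuous as soon as the bumps are
  uniformly equicontinuous. There are two ways to have that: the heights of the bumps tend to \<open>0\<close>, the
  radii being arbitrary (\<open>vanishing_bumps\<close>), or the heights are at most a constant times the radii,
  which are measured in \<open>d\<^sub>\<epsilon>\<close> (\<open>chain_bumps\<close>).

  Near an accumulation point \<open>x\<^sub>0\<close> bumps of the first kind interpolate \<open>e\<^sub>n \<rightarrow> e\<^sub>0\<close> at points
  \<open>x\<^sub>n \<rightarrow> x\<^sub>0\<close> different from \<open>x\<^sub>0\<close>. This controls \<open>\<Xi>\<close> off the fibre over \<open>x\<^sub>0\<close>; the fibre itself is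
  then reached as a limit of nearby fibres.

  For a u-sequence \<open>(x\<^sub>n, e\<^sub>n)\<close>, extending \<open>x\<^sub>n \<mapsto> e\<^sub>n\<close> from all of \<open>{x\<^sub>n}\<close> would be a Lipschitz extension
  problem with values in a Banach space, for which no general theorem exists. Passing to a subsequence
  makes it easy: if \<open>(e\<^sub>n)\<close> is bounded, bumps of a fixed radius suffice, and otherwise a subsequence has
  norms growing so fast that the \<open>d\<^sub>\<epsilon>\<close>-balls around \<open>x\<^sub>n\<close> of radius proportional to \<open>\<parallel>e\<^sub>n\<parallel> + 1\<close> are disjoint
  (\<open>u_sequence_interpolation\<close>). Vanishing bumps at the perturbed points \<open>x'\<^sub>n\<close> finally correct the values
  there (\<open>u_sequence_double_interpolation\<close>).
\<close>

section \<open>Extraction of subsequences\<close>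

text \<open>
  A relation that each finite initial segment of indices bears to some later index can be made to hold
  between all terms of a subsequence: choose greedily, each time beyond and against everything up to the
  last chosen index. It serves to extract separated, rapidly shrinking and rapidly growing subsequences.
\<close>

lemma subseq_pairwise:
  fixes R :: "nat \<Rightarrow> nat \<Rightarrow> bool"
  assumes "\<And>N. \<exists>j>N. \<forall>i\<le>N. R i j"
  obtains k :: "nat \<Rightarrow> nat" where "strict_mono k" "\<And>m n. m < n \<Longrightarrow> R (k m) (k n)"
proof -
  have "\<exists>k. \<forall>n. True \<and> (k n < k (Suc n) \<and> (\<forall>i\<le>k n. R i (k (Suc n))))"
    using assms by (intro dependent_nat_choice) auto
  then obtain k where k: "\<And>n. k n < k (Suc n)" "\<And>n i. i \<le> k n \<Longrightarrow> R i (k (Suc n))"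
    by blast
  have mono: "strict_mono k"
    using k(1) by (simp add: strict_mono_Suc_iff)
  have "R (k m) (k n)" if mn: "m < n" for m n
  proof -
    obtain n' where n': "n = Suc n'" "m \<le> n'"
      using mn by (auto simp: less_iff_Suc_add)
    then have "k m \<le> k n'"
      using mono by (simp add: strict_mono_less_eq)
    then show ?thesis
      using k(2) n'(1) by simp
  qed
  then show ?thesis by (rule that[OF mono])
qed

lemma separated_seq_iff:
  "separated_seq x \<longleftrightarrow> (\<exists>r>0. \<forall>n m. n \<noteq> m \<longrightarrow> r \<le> dist (x n) (x m))"
proof
  let ?I = "{(n, m). n \<noteq> (m::nat)}"
  let ?f = "\<lambda>(n, m). dist (x n) (x m)"
  assume "separated_seq x"
  then have pos: "0 < Inf (?f ` ?I)"
    by (simp add: separated_seq_def)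
  moreover have "Inf (?f ` ?I) \<le> dist (x n) (x m)" if "n \<noteq> m" for n m
  proof (rule cINF_lower2[where x = "(n, m)"])
    show "bdd_below (?f ` ?I)"
      by (rule bdd_belowI[of _ 0]) auto
  qed (use that in auto)
  ultimately show "\<exists>r>0. \<forall>n m. n \<noteq> m \<longrightarrow> r \<le> dist (x n) (x m)"
    by blast
next
  assume "\<exists>r>0. \<forall>n m. n \<noteq> m \<longrightarrow> r \<le> dist (x n) (x m)"
  then obtain r where r: "r > 0" "\<And>n m. n \<noteq> m \<Longrightarrow> r \<le> dist (x n) (x m)"
    by blast
  have "(0, 1) \<in> {(n, m). n \<noteq> (m::nat)}" by simp
  then have "r \<le> (INF (n, m) \<in> {(n, m). n \<noteq> m}. dist (x n) (x m))"
    using r(2) by (intro cINF_greatest) auto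
  with r(1) show "separated_seq x"
    by (simp add: separated_seq_def)
qed

text \<open>
  If the range is totally bounded, its closure is compact. Otherwise, for some \<open>e\<close>, no finitely many
  terms have \<open>e\<close>-balls covering the range, so that there is always another term at distance at least
  \<open>e\<close> from all earlier ones.
\<close>

lemma convergent_or_separated_subseq:
  fixes x :: "nat \<Rightarrow> 'a::complete_space"
  obtains (convergent) l and k :: "nat \<Rightarrow> nat" where "strict_mono k" "(x \<circ> k) \<longlonglongrightarrow> l"
  | (separated) k :: "nat \<Rightarrow> nat" where "strict_mono k" "separated_seq (x \<circ> k)"
proof (cases "\<forall>e>0. \<exists>K. finite K \<and> range x \<subseteq> (\<Union>c\<in>K. ball c e)")
  case True
  have "\<exists>K. finite K \<and> closure (range x) \<subseteq> (\<Union>c\<in>K. ball c e)" if "e > 0" for e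
  proof -
    obtain K where K: "finite K" "range x \<subseteq> (\<Union>c\<in>K. ball c (e/2))"
      using True \<open>e > 0\<close> half_gt_zero by blast
    have "closure (range x) \<subseteq> (\<Union>c\<in>K. cball c (e/2))"
    proof (rule closure_minimal)
      show "range x \<subseteq> (\<Union>c\<in>K. cball c (e/2))"
        using K(2) ball_subset_cball by blast
      show "closed (\<Union>c\<in>K. cball c (e/2))"
        using K(1) by (intro closed_UN) auto
    qed
    also have "\<dots> \<subseteq> (\<Union>c\<in>K. ball c e)"
      using \<open>e > 0\<close> by (intro UN_mono subset_refl) auto
    finally show ?thesis using K(1) by blast
  qed
  then have "seq_compact (closure (range x))"
    by (simp add: compact_eq_seq_compact_metric[symmetric] compact_eq_totally_bounded
        complete_eq_closed)
  then show ?thesis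
    using convergent closure_subset[of "range x"]
    by (elim seq_compactE[where f = x]) auto
next
  case False
  then obtain e where e: "e > 0" "\<And>K. finite K \<Longrightarrow> \<not> range x \<subseteq> (\<Union>c\<in>K. ball c e)"
    by blast
  have "\<exists>j>N. \<forall>i\<le>N. e \<le> dist (x i) (x j)" for N
  proof -
    obtain j where j: "x j \<notin> (\<Union>c\<in>x ` {..N}. ball c e)"
      using e(2)[of "x ` {..N}"] by blast
    then have far: "e \<le> dist (x i) (x j)" if "i \<le> N" for i
      using that by (auto simp: not_less)
    have "j > N"
      using far[of j] e(1) by (cases "j \<le> N") auto
    with far show ?thesis by blast
  qed
  from subseq_pairwise[OF this] obtain k :: "nat \<Rightarrow> nat" where
    k: "strict_mono k" "\<And>m n. m < n \<Longrightarrow> e \<le> dist (x (k m)) (x (k n))"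
    by blast
  have "e \<le> dist (x (k m)) (x (k n))" if "m \<noteq> n" for m n :: nat
    using that k(2)[of m n] k(2)[of n m]
    by (cases m n rule: linorder_cases) (auto simp: dist_commute)
  then have "separated_seq (x \<circ> k)"
    using e(1) by (auto simp: separated_seq_iff)
  with k(1) separated show ?thesis by blast
qed

section \<open>The chain distance\<close>

lemma chainsE:
  assumes "c \<in> chains \<epsilon> a b"
  obtains n x where "c = (n, x)" "x 0 = a" "x n = b"
    "\<And>i. i < n \<Longrightarrow> dist (x i) (x (Suc i)) \<le> \<epsilon>"
proof -
  obtain n x where c: "c = (n, x)" by (cases c)
  have step: "dist (x i) (x (Suc i)) \<le> \<epsilon>" if "i < n" for i
  proof -
    have "Suc i \<in> {1..n}" using that by simp
    then show ?thesis using assms unfolding c chains_def by fastforce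
  qed
  show thesis
    by (rule that[OF c]) (use assms step in \<open>auto simp: c chains_def\<close>)
qed

text \<open>
  The form in which lower bounds of the chain distance are used, with the steps indexed from \<open>0\<close> so
  that partial sums over \<open>{..<j}\<close> allow induction along the chain.
\<close>

lemma chain_dist_greatest:
  assumes "\<And>n x. x 0 = a \<Longrightarrow> x n = b \<Longrightarrow> (\<And>i. i < n \<Longrightarrow> dist (x i) (x (Suc i)) \<le> \<epsilon>)
    \<Longrightarrow> z \<le> ennreal (\<Sum>i<n. dist (x i) (x (Suc i)))"
  shows "z \<le> chain_dist \<epsilon> a b"
  unfolding chain_dist_def
proof (rule INF_greatest)
  fix c assume "c \<in> chains \<epsilon> a b"
  then obtain n x where c: "c = (n, x)" "x 0 = a" "x n = b"
    "\<And>i. i < n \<Longrightarrow> dist (x i) (x (Suc i)) \<le> \<epsilon>"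
    by (rule chainsE) blast
  have "(\<Sum>i=1..n. dist (x (i - 1)) (x i)) = (\<Sum>i<n. dist (x i) (x (Suc i)))"
    using sum.atLeast1_atMost_eq[of "\<lambda>i. dist (x (i - 1)) (x i)" n] by simp
  then show "z \<le> (case c of (n, x) \<Rightarrow> ennreal (\<Sum>i=1..n. dist (x (i - 1)) (x i)))"
    using assms[OF c(2,3,4)] c(1) by simp
qed

lemma dist_le_chain_dist: "ennreal (dist a b) \<le> chain_dist \<epsilon> a b"
proof (rule chain_dist_greatest)
  fix n and x :: "nat \<Rightarrow> 'a"
  assume x: "x 0 = a" "x n = b"
  have "dist (x 0) (x n) \<le> (\<Sum>i<n. dist (x i) (x (Suc i)))"
  proof (induction n)
    case (Suc n)
    then show ?case
      using dist_triangle[of "x 0" "x (Suc n)" "x n"] by simp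
  qed simp
  then show "ennreal (dist a b) \<le> ennreal (\<Sum>i<n. dist (x i) (x (Suc i)))"
    using x by (simp add: ennreal_leI)
qed

lemma chain_dist_le_dist:
  assumes "dist a b \<le> \<epsilon>"
  shows "chain_dist \<epsilon> a b \<le> ennreal (dist a b)"
proof -
  let ?x = "\<lambda>i::nat. if i = 0 then a else b"
  have "(1, ?x) \<in> chains \<epsilon> a b"
    using assms by (simp add: chains_def)
  from INF_lower[OF this, of "\<lambda>(n, x). ennreal (\<Sum>i=1..n. dist (x (i - 1)) (x i))"]
  show ?thesis by (simp add: chain_dist_def)
qed

lemma chain_dist_self:
  assumes "\<epsilon> > 0"
  shows "chain_dist \<epsilon> a a = 0"
  using chain_dist_le_dist[of a a \<epsilon>] assms by simp

text \<open>
  A single admissible step prolongs any chain. Hence \<open>d\<^sub>\<epsilon>(a, \<cdot>)\<close> is 1-Lipschitz at scale \<open>\<epsilon>\<close>, even where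
  it is infinite.
\<close>

lemma chain_dist_step:
  assumes "dist b c \<le> \<epsilon>"
  shows "chain_dist \<epsilon> a c \<le> chain_dist \<epsilon> a b + ennreal (dist b c)"
proof -
  have "chain_dist \<epsilon> a c - ennreal (dist b c) \<le> chain_dist \<epsilon> a b"
  proof (rule chain_dist_greatest)
    fix n x
    assume x: "x 0 = a" "x n = b" "\<And>i. i < n \<Longrightarrow> dist (x i) (x (Suc i)) \<le> \<epsilon>"
    let ?y = "x(Suc n := c)"
    have "dist (?y (i - 1)) (?y i) \<le> \<epsilon>" if "i \<in> {1..Suc n}" for i
      using that x(3)[of "i - 1"] x(2) assms by auto
    then have "(Suc n, ?y) \<in> chains \<epsilon> a c"
      using x(1) by (simp add: chains_def)
    from INF_lower[OF this, of "\<lambda>(n, x). ennreal (\<Sum>i=1..n. dist (x (i - 1)) (x i))"]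
    have "chain_dist \<epsilon> a c \<le> ennreal (\<Sum>i=1..Suc n. dist (?y (i - 1)) (?y i))"
      by (simp add: chain_dist_def)
    also have "(\<Sum>i=1..Suc n. dist (?y (i - 1)) (?y i)) = (\<Sum>i<Suc n. dist (?y i) (?y (Suc i)))"
      using sum.atLeast1_atMost_eq[of "\<lambda>i. dist (?y (i - 1)) (?y i)" "Suc n"] by simp
    also have "\<dots> = (\<Sum>i<n. dist (x i) (x (Suc i))) + dist b c"
      using x(2) by simp
    finally show "chain_dist \<epsilon> a c - ennreal (dist b c) \<le> ennreal (\<Sum>i<n. dist (x i) (x (Suc i)))"
      by (simp add: ennreal_minus_le_iff sum_nonneg add.commute)
  qed
  then show ?thesis
    by (simp add: ennreal_minus_le_iff add.commute)
qed

text \<open>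
  The triangle inequality in the form that shows disjointness of two balls with centres \<open>a\<close> and \<open>b\<close>:
  walking along a chain from \<open>b\<close> to \<open>z\<close>, each step changes the distance from \<open>a\<close> by at most its own
  length.
\<close>

lemma chain_dist_triangle:
  "chain_dist \<epsilon> a b \<le> chain_dist \<epsilon> a z + chain_dist \<epsilon> b z"
proof (cases "chain_dist \<epsilon> a z = top")
  case False
  have "chain_dist \<epsilon> a b - chain_dist \<epsilon> a z \<le> chain_dist \<epsilon> b z"
  proof (rule chain_dist_greatest)
    fix n x
    assume x: "x 0 = b" "x n = z" "\<And>i. i < n \<Longrightarrow> dist (x i) (x (Suc i)) \<le> \<epsilon>"
    have "chain_dist \<epsilon> a b \<le> chain_dist \<epsilon> a (x j) + ennreal (\<Sum>i<j. dist (x i) (x (Suc i)))"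
      if "j \<le> n" for j
      using that
    proof (induction j)
      case (Suc j)
      have "chain_dist \<epsilon> a b \<le> chain_dist \<epsilon> a (x j) + ennreal (\<Sum>i<j. dist (x i) (x (Suc i)))"
        using Suc by simp
      also have "\<dots> \<le> (chain_dist \<epsilon> a (x (Suc j)) + ennreal (dist (x (Suc j)) (x j)))
          + ennreal (\<Sum>i<j. dist (x i) (x (Suc i)))"
        using x(3)[of j] Suc.prems
        by (intro add_right_mono chain_dist_step) (simp add: dist_commute)
      also have "\<dots> = chain_dist \<epsilon> a (x (Suc j)) + ennreal (\<Sum>i<Suc j. dist (x i) (x (Suc i)))"
        by (simp add: ennreal_plus sum_nonneg dist_commute add_ac del: ennreal_plus_if)
      finally show ?case .
    qed (use x in simp)
    from this[of n] show "chain_dist \<epsilon> a b - chain_dist \<epsilon> a z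
        \<le> ennreal (\<Sum>i<n. dist (x i) (x (Suc i)))"
      using x(2) False by (simp add: ennreal_minus_le_iff)
  qed
  then show ?thesis
    using False by (simp add: ennreal_minus_le_iff)
qed simp

text \<open>
  Equivalently, \<open>\<parallel>f(a) - f(b)\<parallel> \<le> 1 + d\<^sub>\<epsilon>(a, b) / \<epsilon>\<close>. Many short steps of a chain cannot be charged one unit
  each, so they are merged: follow the chain with a marker \<open>p\<close> lagging behind, and move the marker up
  only when the length \<open>t\<close> walked since it was last moved would exceed \<open>\<epsilon>\<close>. Such a move covers at most
  \<open>2\<epsilon>\<close>, changes \<open>f\<close> by at most \<open>1\<close>, and uses up more than \<open>\<epsilon>\<close> of the length of the chain.
\<close>

lemma uniformly_continuous_large_scale_lipschitz:
  fixes f :: "'a::metric_space \<Rightarrow> 'b::real_normed_vector"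
  assumes "\<epsilon> > 0" and f: "\<And>x y. dist x y \<le> 2 * \<epsilon> \<Longrightarrow> norm (f x - f y) \<le> 1"
  shows "ennreal (\<epsilon> * (norm (f a - f b) - 1)) \<le> chain_dist \<epsilon> a b"
proof (rule chain_dist_greatest)
  fix n x
  assume x: "x 0 = a" "x n = b" "\<And>i. i < n \<Longrightarrow> dist (x i) (x (Suc i)) \<le> \<epsilon>"
  define L where "L j = (\<Sum>i<j. dist (x i) (x (Suc i)))" for j
  have "\<exists>p t. dist p (x j) \<le> t \<and> t \<le> \<epsilon> \<and> \<epsilon> * norm (f a - f p) \<le> L j - t" if "j \<le> n" for j
    using that
  proof (induction j)
    case 0
    then show ?case
      using \<open>\<epsilon> > 0\<close> by (intro exI[of _ a] exI[of _ 0]) (simp add: L_def x)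
  next
    case (Suc j)
    then obtain p t where pt: "dist p (x j) \<le> t" "t \<le> \<epsilon>" "\<epsilon> * norm (f a - f p) \<le> L j - t"
      by auto
    let ?d = "dist (x j) (x (Suc j))"
    have d: "?d \<le> \<epsilon>" using x(3) Suc.prems by simp
    have far: "dist p (x (Suc j)) \<le> t + ?d"
      using dist_triangle[of p "x (Suc j)" "x j"] pt(1) by simp
    have L: "L (Suc j) = L j + ?d" by (simp add: L_def)
    show ?case
    proof (cases "t + ?d \<le> \<epsilon>")
      case True
      then show ?thesis
        using far pt L by (intro exI[of _ p] exI[of _ "t + ?d"]) simp
    next
      case False
      have "norm (f p - f (x (Suc j))) \<le> 1"
        using far pt(2) d by (intro f) simp
      then have "norm (f a - f (x (Suc j))) \<le> norm (f a - f p) + 1"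
        using norm_triangle_ineq[of "f a - f p" "f p - f (x (Suc j))"] by simp
      then have "\<epsilon> * norm (f a - f (x (Suc j))) \<le> \<epsilon> * norm (f a - f p) + \<epsilon>"
        using \<open>\<epsilon> > 0\<close> mult_left_mono[of _ _ \<epsilon>] by (fastforce simp: algebra_simps)
      then show ?thesis
        using False pt(3) L \<open>\<epsilon> > 0\<close>
        by (intro exI[of _ "x (Suc j)"] exI[of _ 0]) simp
    qed
  qed
  then obtain p t where pt: "dist p b \<le> t" "t \<le> \<epsilon>" "\<epsilon> * norm (f a - f p) \<le> L n - t"
    using x(2) by blast
  have "norm (f p - f b) \<le> 1"
    using pt \<open>\<epsilon> > 0\<close> by (intro f) simp
  then have "norm (f a - f b) - 1 \<le> norm (f a - f p)"
    using norm_triangle_ineq[of "f a - f p" "f p - f b"] by simp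
  then have "\<epsilon> * (norm (f a - f b) - 1) \<le> \<epsilon> * norm (f a - f p)"
    using \<open>\<epsilon> > 0\<close> by (simp add: mult_left_mono)
  also have "\<dots> \<le> L n"
    using pt zero_le_dist[of p b] by linarith
  finally show "ennreal (\<epsilon> * (norm (f a - f b) - 1)) \<le> ennreal (\<Sum>i<n. dist (x i) (x (Suc i)))"
    by (simp add: L_def ennreal_leI)
qed

text \<open>
  On a separated sequence the additive constant of the large-scale Lipschitz bound is absorbed into the
  factor: distinct points have \<open>d\<^sub>\<epsilon>\<close>-distance at least \<open>r\<close>, so \<open>1 \<le> d\<^sub>\<epsilon> / r\<close>.
\<close>

lemma u_sequence_graph:
  fixes f :: "'a::metric_space \<Rightarrow> 'b::real_normed_vector"
  assumes f: "uniformly_continuous_on UNIV f" and x: "separated_seq x"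
  shows "u_sequence (\<lambda>n. (x n, f (x n)))"
proof -
  obtain r where r: "r > 0" "\<And>n m. n \<noteq> m \<Longrightarrow> r \<le> dist (x n) (x m)"
    using x by (auto simp: separated_seq_iff)
  obtain \<delta> where \<delta>: "\<delta> > 0" "\<And>x y. dist x y < \<delta> \<Longrightarrow> dist (f x) (f y) < 1"
    using f unfolding uniformly_continuous_on_def by (metis UNIV_I dist_commute zero_less_one)
  \<comment> \<open>so that \<open>2\<epsilon> < \<delta>\<close>: the large-scale bound needs the modulus at scale \<open>2\<epsilon>\<close>\<close>
  define \<epsilon> where "\<epsilon> = \<delta> / 3"
  have \<epsilon>: "\<epsilon> > 0" "\<And>x y. dist x y \<le> 2 * \<epsilon> \<Longrightarrow> norm (f x - f y) \<le> 1"
    using \<delta>(1) by (auto simp: \<epsilon>_def dist_norm[symmetric] intro!: less_imp_le[OF \<delta>(2)])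
  define C where "C = 1 / r + 1 / \<epsilon>"
  have C: "C \<ge> 0" using r(1) \<epsilon>(1) by (simp add: C_def)
  have "ennreal (norm (f (x n) - f (x m))) \<le> ennreal C * chain_dist \<epsilon> (x n) (x m)" for n m
  proof (cases "n = m")
    case False
    show ?thesis
    proof (cases "chain_dist \<epsilon> (x n) (x m)")
      case (real D)
      have "\<epsilon> * (norm (f (x n) - f (x m)) - 1) \<le> D"
        using uniformly_continuous_large_scale_lipschitz[OF \<epsilon>, where a = "x n" and b = "x m"] real
        by (simp add: ennreal_le_iff)
      then have "norm (f (x n) - f (x m)) \<le> 1 + D / \<epsilon>"
        using \<epsilon>(1) by (simp add: field_simps)
      also have "1 \<le> D / r"
        using dist_le_chain_dist[of "x n" "x m" \<epsilon>] r(1) r(2)[OF False] real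
        by (simp add: ennreal_le_iff)
      finally have "norm (f (x n) - f (x m)) \<le> C * D"
        by (simp add: C_def algebra_simps)
      then show ?thesis
        using real C by (simp add: ennreal_mult[symmetric] ennreal_leI)
    next
      case top
      have "C > 0" using r(1) \<epsilon>(1) by (simp add: C_def add_pos_pos)
      then show ?thesis by (simp add: top ennreal_mult_top)
    qed
  qed simp
  then show ?thesis
    using x \<epsilon>(1) unfolding u_sequence_def
    by (auto intro!: exI[of _ \<epsilon>] exI[of _ "ennreal C"])
qed

section \<open>Disjoint sums of bumps\<close>

lemma suminf_disjoint:
  fixes g :: "nat \<Rightarrow> 'a \<Rightarrow> 'b::real_normed_vector"
  assumes "\<And>n m. g n x \<noteq> 0 \<Longrightarrow> g m x \<noteq> 0 \<Longrightarrow> n = m"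
  obtains n where "(\<Sum>k. g k x) = g n x" "\<And>k. k \<noteq> n \<Longrightarrow> g k x = 0"
proof -
  obtain n where n: "\<And>k. k \<noteq> n \<Longrightarrow> g k x = 0"
    using assms by (metis (full_types))
  then have "(\<Sum>k. g k x) = (\<Sum>k\<in>{n}. g k x)"
    by (intro suminf_finite) auto
  with n that show ?thesis by simp
qed

text \<open>
  If \<open>x\<close> lies in the support of \<open>g\<^sub>n\<close> and \<open>y\<close> in that of \<open>g\<^sub>m\<close> with \<open>m \<noteq> n\<close>, then \<open>g\<^sub>n\<close> vanishes at \<open>y\<close> and
  \<open>g\<^sub>m\<close> at \<open>x\<close>, so the sum varies between \<open>x\<close> and \<open>y\<close> by at most the variations of two of the summands.
\<close>

lemma uniformly_continuous_disjoint_sum: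
  fixes g :: "nat \<Rightarrow> 'a::metric_space \<Rightarrow> 'b::real_normed_vector"
  assumes equi: "\<And>\<eta>. \<eta> > 0 \<Longrightarrow> \<exists>\<delta>>0. \<forall>n x y. dist x y < \<delta> \<longrightarrow> norm (g n x - g n y) < \<eta>"
    and disj: "\<And>n m x. g n x \<noteq> 0 \<Longrightarrow> g m x \<noteq> 0 \<Longrightarrow> n = m"
  shows "uniformly_continuous_on UNIV (\<lambda>x. \<Sum>n. g n x)"
  unfolding uniformly_continuous_on_def
proof (intro allI impI)
  fix \<eta> :: real assume "\<eta> > 0"
  then obtain \<delta> where \<delta>: "\<delta> > 0"
    "\<And>n x y. dist x y < \<delta> \<Longrightarrow> norm (g n x - g n y) < \<eta> / 2"
    using equi[of "\<eta> / 2"] by auto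
  have "dist (\<Sum>n. g n x) (\<Sum>n. g n y) < \<eta>" if xy: "dist x y < \<delta>" for x y
  proof -
    obtain n where n: "(\<Sum>k. g k x) = g n x" "\<And>k. k \<noteq> n \<Longrightarrow> g k x = 0"
      using suminf_disjoint[of g x] disj by blast
    obtain m where m: "(\<Sum>k. g k y) = g m y" "\<And>k. k \<noteq> m \<Longrightarrow> g k y = 0"
      using suminf_disjoint[of g y] disj by blast
    show ?thesis
    proof (cases "n = m")
      case True
      then show ?thesis
        using \<delta>(2)[OF xy, of n] n(1) m(1) \<open>\<eta> > 0\<close> by (simp add: dist_norm)
    next
      case False
      then have "g n x - g m y = (g n x - g n y) + (g m x - g m y)"
        using n(2) m(2) by simp
      then have "norm (g n x - g m y) \<le> norm (g n x - g n y) + norm (g m x - g m y)"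
        by (metis norm_triangle_ineq)
      also have "\<dots> < \<eta>"
        using \<delta>(2)[OF xy, of n] \<delta>(2)[OF xy, of m] by simp
      finally show ?thesis
        using n(1) m(1) by (simp add: dist_norm)
    qed
  qed
  then show "\<exists>\<delta>>0. \<forall>x\<in>UNIV. \<forall>x'\<in>UNIV. dist x' x < \<delta> \<longrightarrow>
      dist (\<Sum>n. g n x') (\<Sum>n. g n x) < \<eta>"
    using \<delta>(1) by blast
qed

text \<open>
  Only finitely many heights exceed a given \<open>\<eta>\<close>. The bumps of height below \<open>\<eta>\<close> vary by less than \<open>\<eta>\<close>
  however narrow they are, and the finitely many others have a common Lipschitz constant.
\<close>

lemma vanishing_bumps:
  fixes p :: "nat \<Rightarrow> 'a::metric_space" and w :: "nat \<Rightarrow> 'b::real_normed_vector"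
  assumes \<rho>: "\<And>n. \<rho> n > 0" and p: "\<And>n m. n \<noteq> m \<Longrightarrow> \<rho> n + \<rho> m \<le> dist (p n) (p m)"
    and w: "w \<longlonglongrightarrow> 0"
  obtains f where "uniformly_continuous_on UNIV f" "\<And>n. f (p n) = w n"
    "\<And>x. (\<And>n. \<rho> n \<le> dist (p n) x) \<Longrightarrow> f x = 0"
proof -
  define c where "c n x = max 0 (1 - dist (p n) x / \<rho> n)" for n x
  define g where "g n x = c n x *\<^sub>R w n" for n x
  have c01: "0 \<le> c n x" "c n x \<le> 1" for n x
    using \<rho>[of n] by (auto simp: c_def)
  have c0: "c n x = 0" if "\<rho> n \<le> dist (p n) x" for n x
    using that \<rho>[of n] by (simp add: c_def)
  have disj: "n = m" if "g n x \<noteq> 0" "g m x \<noteq> 0" for n m x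
  proof (rule ccontr)
    assume "n \<noteq> m"
    have "dist (p n) x < \<rho> n" "dist (p m) x < \<rho> m"
      using that c0 by (force simp: g_def not_le[symmetric])+
    then show False
      using p[OF \<open>n \<noteq> m\<close>] dist_triangle2[of "p n" "p m" x] by linarith
  qed
  have lip: "\<bar>c n x - c n y\<bar> \<le> dist x y / \<rho> n" for n x y
  proof -
    have "\<bar>c n x - c n y\<bar> \<le> \<bar>dist (p n) x / \<rho> n - dist (p n) y / \<rho> n\<bar>"
      by (simp add: c_def max_def abs_if)
    also have "\<dots> = \<bar>dist (p n) x - dist (p n) y\<bar> / \<rho> n"
      using \<rho>[of n] by (simp add: diff_divide_distrib[symmetric])
    also have "\<bar>dist (p n) x - dist (p n) y\<bar> \<le> dist x y"
      using dist_triangle[of "p n" x y] dist_triangle[of "p n" y x] by (simp add: dist_commute abs_le_iff)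
    finally show ?thesis
      using \<rho>[of n] by (simp add: divide_right_mono)
  qed
  have equi: "\<exists>\<delta>>0. \<forall>n x y. dist x y < \<delta> \<longrightarrow> norm (g n x - g n y) < \<eta>" if "\<eta> > 0" for \<eta>
  proof -
    obtain N where N: "\<And>n. n \<ge> N \<Longrightarrow> norm (w n) < \<eta>"
      using w \<open>\<eta> > 0\<close> by (auto simp: LIMSEQ_iff)
    define L where "L = (\<Sum>n<N. norm (w n) / \<rho> n)"
    have L: "L \<ge> 0"
      unfolding L_def using \<rho> by (intro sum_nonneg) (simp add: less_imp_le)
    have "norm (g n x - g n y) < \<eta>" if xy: "dist x y < \<eta> / (L + 1)" for n x y
    proof -
      have eq: "norm (g n x - g n y) = \<bar>c n x - c n y\<bar> * norm (w n)"
        by (simp add: g_def scaleR_diff_left[symmetric])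
      show ?thesis
      proof (cases "n < N")
        case True
        have "\<bar>c n x - c n y\<bar> * norm (w n) \<le> dist x y / \<rho> n * norm (w n)"
          by (intro mult_right_mono lip) simp
        also have "\<dots> = dist x y * (norm (w n) / \<rho> n)" by simp
        also have "norm (w n) / \<rho> n \<le> L"
          unfolding L_def using True \<rho>
          by (intro member_le_sum) (auto simp: less_imp_le)
        then have "dist x y * (norm (w n) / \<rho> n) \<le> dist x y * (L + 1)"
          by (intro mult_left_mono) auto
        also have "\<dots> < \<eta>"
          using xy L by (simp add: pos_less_divide_eq)
        finally show ?thesis using eq by simp
      next
        case False
        have "\<bar>c n x - c n y\<bar> * norm (w n) \<le> 1 * norm (w n)"
          using c01[of n x] c01[of n y] by (intro mult_right_mono) auto
        then show ?thesis
          using eq N[of n] False by simp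
      qed
    qed
    moreover have "\<eta> / (L + 1) > 0" using L \<open>\<eta> > 0\<close> by simp
    ultimately show ?thesis by blast
  qed
  show ?thesis
  proof
    show "uniformly_continuous_on UNIV (\<lambda>x. \<Sum>n. g n x)"
      using equi disj by (rule uniformly_continuous_disjoint_sum)
  next
    fix n
    have other: "g k (p n) = 0" if "k \<noteq> n" for k
      using c0[of k "p n"] p[OF that] \<rho>[of n] by (simp add: g_def)
    have "(\<Sum>k. g k (p n)) = (\<Sum>k\<in>{n}. g k (p n))"
      using other by (intro suminf_finite) auto
    also have "\<dots> = w n" by (simp add: g_def c_def)
    finally show "(\<Sum>k. g k (p n)) = w n" .
  next
    fix x assume "\<And>n. \<rho> n \<le> dist (p n) x"
    then show "(\<Sum>k. g k x) = 0" by (simp add: g_def c0)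
  qed
qed

text \<open>
  Here the bump at \<open>p\<^sub>n\<close> is the cone \<open>max(0, \<rho>\<^sub>n - d\<^sub>\<epsilon>(p\<^sub>n, x))\<close> times a vector of norm at most \<open>\<bar>K\<bar>\<close>. The
  cones are 1-Lipschitz at scale \<open>\<epsilon>\<close>, so the bumps are uniformly equicontinuous even if their heights are
  unbounded. Truncated subtraction in the extended nonnegative reals makes a cone vanish also at points
  that no \<open>\<epsilon>\<close>-chain joins to its centre.
\<close>

lemma chain_bumps:
  fixes p :: "nat \<Rightarrow> 'a::metric_space" and w :: "nat \<Rightarrow> 'b::real_normed_vector"
  assumes \<epsilon>: "\<epsilon> > 0" and \<rho>: "\<And>n. \<rho> n > 0"
    and p: "\<And>n m. n \<noteq> m \<Longrightarrow> ennreal (\<rho> n + \<rho> m) \<le> chain_dist \<epsilon> (p n) (p m)"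
    and w: "\<And>n. norm (w n) \<le> K * \<rho> n"
  obtains f where "uniformly_continuous_on UNIV f" "\<And>n. f (p n) = w n"
proof -
  define c where "c n x = enn2real (ennreal (\<rho> n) - chain_dist \<epsilon> (p n) x)" for n x
  define v where "v n = (1 / \<rho> n) *\<^sub>R w n" for n
  define g where "g n x = c n x *\<^sub>R v n" for n x
  have v: "norm (v n) \<le> \<bar>K\<bar>" for n
    using w[of n] \<rho>[of n] by (simp add: v_def field_simps) (smt (verit) mult_right_mono)
  have c0: "c n x = 0" if "ennreal (\<rho> n) \<le> chain_dist \<epsilon> (p n) x" for n x
    using that by (simp add: c_def diff_eq_0_ennreal)
  have disj: "n = m" if "g n x \<noteq> 0" "g m x \<noteq> 0" for n m x
  proof (rule ccontr)
    assume "n \<noteq> m"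
    have "chain_dist \<epsilon> (p n) x < ennreal (\<rho> n)" "chain_dist \<epsilon> (p m) x < ennreal (\<rho> m)"
      using that c0 by (force simp: g_def not_le[symmetric])+
    then have "chain_dist \<epsilon> (p n) x + chain_dist \<epsilon> (p m) x < ennreal (\<rho> n + \<rho> m)"
      using \<rho>[of n] \<rho>[of m] by (simp add: ennreal_plus add_strict_mono del: ennreal_plus_if)
    then show False
      using p[OF \<open>n \<noteq> m\<close>] chain_dist_triangle[of \<epsilon> "p n" "p m" x] by (meson leD order_trans)
  qed
  have half: "c n x \<le> c n y + dist x y" if "dist x y \<le> \<epsilon>" for n x y
  proof -
    have "chain_dist \<epsilon> (p n) y \<le> chain_dist \<epsilon> (p n) x + ennreal (dist x y)"
      using that by (rule chain_dist_step)
    then show ?thesis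
      using \<rho>[of n] unfolding c_def
      by (cases "chain_dist \<epsilon> (p n) x"; cases "chain_dist \<epsilon> (p n) y")
        (auto simp: ennreal_minus_if top_unique ennreal_plus[symmetric] ennreal_le_iff simp del: ennreal_plus)
  qed
  have lip: "\<bar>c n x - c n y\<bar> \<le> dist x y" if "dist x y \<le> \<epsilon>" for n x y
    using half[OF that, of n] half[of y x n] that by (simp add: dist_commute abs_le_iff)
  have equi: "\<exists>\<delta>>0. \<forall>n x y. dist x y < \<delta> \<longrightarrow> norm (g n x - g n y) < \<eta>" if "\<eta> > 0" for \<eta>
  proof -
    have "norm (g n x - g n y) < \<eta>" if xy: "dist x y < min \<epsilon> (\<eta> / (\<bar>K\<bar> + 1))" for n x y
    proof -
      have "norm (g n x - g n y) = \<bar>c n x - c n y\<bar> * norm (v n)"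
        by (simp add: g_def scaleR_diff_left[symmetric])
      also have "\<dots> \<le> dist x y * (\<bar>K\<bar> + 1)"
        using xy v[of n] by (intro mult_mono lip) auto
      also have "\<dots> < \<eta>"
        using xy by (simp add: pos_less_divide_eq)
      finally show ?thesis .
    qed
    moreover have "min \<epsilon> (\<eta> / (\<bar>K\<bar> + 1)) > 0" using \<epsilon> \<open>\<eta> > 0\<close> by simp
    ultimately show ?thesis by blast
  qed
  show ?thesis
  proof
    show "uniformly_continuous_on UNIV (\<lambda>x. \<Sum>n. g n x)"
      using equi disj by (rule uniformly_continuous_disjoint_sum)
  next
    fix n
    have other: "g k (p n) = 0" if "k \<noteq> n" for k
    proof -
      have "ennreal (\<rho> k) \<le> ennreal (\<rho> k + \<rho> n)"
        using \<rho>[of n] by (intro ennreal_leI) simp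
      then show ?thesis
        using c0[of k "p n"] p[OF that] by (simp add: g_def)
    qed
    have "(\<Sum>k. g k (p n)) = (\<Sum>k\<in>{n}. g k (p n))"
      using other by (intro suminf_finite) auto
    also have "\<dots> = w n"
      using \<rho>[of n] by (simp add: g_def c_def v_def chain_dist_self[OF \<epsilon>])
    finally show "(\<Sum>k. g k (p n)) = w n" .
  qed
qed

section \<open>Interpolation along u-sequences\<close>

text \<open>
  Division by a positive real constant instead of multiplication by an extended one: the inequality
  then says nothing where the chain distance is infinite, whether or not the original constant is \<open>0\<close>.
\<close>

lemma u_sequenceE:
  assumes "u_sequence s"
  obtains r \<epsilon> C where "r > 0" "\<And>n m. n \<noteq> m \<Longrightarrow> r \<le> dist (fst (s n)) (fst (s m))"
    "\<epsilon> > 0" "C > 0"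
    "\<And>n m. ennreal (norm (snd (s n) - snd (s m)) / C) \<le> chain_dist \<epsilon> (fst (s n)) (fst (s m))"
proof -
  obtain r where r: "r > 0" "\<And>n m. n \<noteq> m \<Longrightarrow> r \<le> dist (fst (s n)) (fst (s m))"
    using assms unfolding u_sequence_def separated_seq_iff by auto
  obtain \<epsilon> C0 where C0: "\<epsilon> > 0" "C0 < \<infinity>"
    "\<And>n m. ennreal (norm (snd (s n) - snd (s m))) \<le> C0 * chain_dist \<epsilon> (fst (s n)) (fst (s m))"
    using assms unfolding u_sequence_def by blast
  obtain C1 where C1: "C0 = ennreal C1" "C1 \<ge> 0"
    using C0(2) by (cases C0) auto
  have "ennreal (norm (snd (s n) - snd (s m)) / (C1 + 1))
      \<le> chain_dist \<epsilon> (fst (s n)) (fst (s m))" for n m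
  proof (cases "chain_dist \<epsilon> (fst (s n)) (fst (s m))")
    case (real D)
    have "norm (snd (s n) - snd (s m)) \<le> C1 * D"
      using C0(3)[of n m] real C1 by (simp add: ennreal_mult[symmetric] ennreal_le_iff)
    also have "\<dots> \<le> (C1 + 1) * D"
      using real by (intro mult_right_mono) auto
    finally show ?thesis
      using real C1(2) by (simp add: ennreal_le_iff field_simps)
  qed simp
  then show ?thesis
    using that[OF r C0(1), of "C1 + 1"] C1(2) by simp
qed

lemma u_sequence_subseq:
  assumes "u_sequence s" "strict_mono k"
  shows "u_sequence (\<lambda>n. s (k n))"
proof -
  have "separated_seq (\<lambda>n. fst (s (k n)))"
    using assms unfolding u_sequence_def separated_seq_iff
    by (metis strict_mono_eq)
  then show ?thesis
    using assms(1) unfolding u_sequence_def by blast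
qed

text \<open>
  If \<open>(e\<^sub>n)\<close> is bounded, bumps of the fixed radius \<open>r / 2\<close> work, where \<open>r\<close> separates the points, because
  \<open>d\<^sub>\<epsilon> \<ge> d\<close>. Otherwise pass to a subsequence along which \<open>\<parallel>e\<^sub>n\<parallel> + 1\<close> grows at least by the factor \<open>4\<close>.
  Then \<open>\<parallel>e\<^sub>n - e\<^sub>m\<parallel>\<close> is comparable to the larger of the two norms, and the u-sequence inequality places
  \<open>x\<^sub>n\<close> and \<open>x\<^sub>m\<close> at \<open>d\<^sub>\<epsilon>\<close>-distance proportional to it, which leaves room for bumps of radius proportional
  to \<open>\<parallel>e\<^sub>n\<parallel> + 1\<close>.
\<close>

lemma u_sequence_interpolation:
  fixes s :: "nat \<Rightarrow> 'a::metric_space \<times> 'b::real_normed_vector"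
  assumes "u_sequence s"
  obtains k :: "nat \<Rightarrow> nat" and f where "strict_mono k" "uniformly_continuous_on UNIV f"
    "\<And>n. f (fst (s (k n))) = snd (s (k n))"
proof -
  obtain r \<epsilon> C where u: "r > 0" "\<And>n m. n \<noteq> m \<Longrightarrow> r \<le> dist (fst (s n)) (fst (s m))"
    "\<epsilon> > 0" "C > 0"
    "\<And>n m. ennreal (norm (snd (s n) - snd (s m)) / C) \<le> chain_dist \<epsilon> (fst (s n)) (fst (s m))"
    using u_sequenceE[OF assms] by metis
  show ?thesis
  proof (cases "Bseq (\<lambda>n. snd (s n))")
    case True
    then obtain K where K: "\<And>n. norm (snd (s n)) \<le> K"
      by (auto simp: Bseq_def)
    have "ennreal (r / 2 + r / 2) \<le> chain_dist \<epsilon> (fst (s n)) (fst (s m))" if "n \<noteq> m" for n m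
      using order_trans[OF ennreal_leI[OF u(2)[OF that]] dist_le_chain_dist]
      by simp
    then obtain f where "uniformly_continuous_on UNIV f" "\<And>n. f (fst (s n)) = snd (s n)"
      using u(1) K
      by (elim chain_bumps[OF u(3), where \<rho> = "\<lambda>_. r / 2" and p = "\<lambda>n. fst (s n)"
            and w = "\<lambda>n. snd (s n)" and K = "2 * K / r", rotated 3]) auto
    then show ?thesis
      using that[of "\<lambda>n. n" f] by (simp add: strict_mono_def)
  next
    case False
    \<comment> \<open>the summand \<open>1\<close> keeps the radii positive where \<open>e\<^sub>n = 0\<close>\<close>
    define a where "a n = norm (snd (s n)) + 1" for n
    have a: "a n > 0" for n by (simp add: a_def add_nonneg_pos)
    have "\<exists>j>N. \<forall>i\<le>N. 4 * a i \<le> a j" for N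
    proof -
      define M where "M = Max ((\<lambda>i. 4 * a i) ` {..N})"
      have M: "4 * a i \<le> M" if "i \<le> N" for i
        unfolding M_def using that by (intro Max_ge) auto
      obtain j where j: "a j > M"
      proof -
        have "\<not> (\<forall>n. norm (snd (s n)) \<le> M)"
          using False by (auto intro: BseqI')
        then obtain j where "norm (snd (s j)) > M" by (auto simp: not_le)
        then show ?thesis using that[of j] by (simp add: a_def)
      qed
      have "j > N"
      proof (rule ccontr)
        assume "\<not> j > N"
        then show False using M[of j] j a[of j] by simp
      qed
      moreover have "\<forall>i\<le>N. 4 * a i \<le> a j"
        using M j by (meson less_imp_le order_trans)
      ultimately show ?thesis by blast
    qed
    from subseq_pairwise[OF this] obtain k :: "nat \<Rightarrow> nat" where
      k: "strict_mono k" "\<And>m n. m < n \<Longrightarrow> 4 * a (k m) \<le> a (k n)"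
      by blast
    define \<rho> where "\<rho> n = a (k n) / (4 * C)" for n
    have less: "\<rho> n + \<rho> m \<le> norm (snd (s (k n)) - snd (s (k m))) / C" if "m < n" for n m
    proof -
      have "norm (snd (s (k n)) - snd (s (k m))) \<ge> a (k n) - a (k m)"
        using norm_triangle_ineq2[of "snd (s (k n))" "snd (s (k m))"] by (simp add: a_def)
      also have "a (k n) - a (k m) \<ge> (a (k n) + a (k m)) / 4"
        using k(2)[OF that] a[of "k m"] by simp
      finally have "(a (k n) + a (k m)) / 4 / C \<le> norm (snd (s (k n)) - snd (s (k m))) / C"
        using u(4) by (intro divide_right_mono) auto
      then show ?thesis
        by (simp add: \<rho>_def add_divide_distrib)
    qed
    have "\<rho> n + \<rho> m \<le> norm (snd (s (k n)) - snd (s (k m))) / C" if "n \<noteq> m" for n m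
      using less[of m n] less[of n m] that by (cases m n rule: linorder_cases) (auto simp: norm_minus_commute add.commute)
    then have sep: "ennreal (\<rho> n + \<rho> m) \<le> chain_dist \<epsilon> (fst (s (k n))) (fst (s (k m)))"
      if "n \<noteq> m" for n m
      using that u(5)[of "k n" "k m"] ennreal_leI by (meson order_trans)
    have "norm (snd (s (k n))) \<le> (4 * C) * \<rho> n" for n
      using u(4) by (simp add: \<rho>_def a_def)
    moreover have "\<rho> n > 0" for n
      using a u(4) by (simp add: \<rho>_def)
    ultimately obtain f where "uniformly_continuous_on UNIV f" "\<And>n. f (fst (s (k n))) = snd (s (k n))"
      using chain_bumps[OF u(3), of \<rho> "\<lambda>n. fst (s (k n))" "\<lambda>n. snd (s (k n))"] sep by blast
    then show ?thesis using that k(1) by blast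
  qed
qed

lemma uniformly_continuous_tendsto:
  fixes f :: "'a::metric_space \<Rightarrow> 'b::real_normed_vector"
  assumes "uniformly_continuous_on UNIV f" "(\<lambda>n. dist (x n) (y n)) \<longlonglongrightarrow> 0"
  shows "(\<lambda>n. f (x n) - f (y n)) \<longlonglongrightarrow> 0"
proof -
  have "(\<lambda>n. dist (f (x n)) (f (y n))) \<longlonglongrightarrow> 0"
    using assms unfolding uniformly_continuous_on_sequentially by simp
  then show ?thesis
    by (simp add: dist_norm tendsto_norm_zero_iff)
qed

text \<open>
  A function \<open>f\<^sub>0\<close> with the right values at the \<open>x\<^sub>n\<close> is off at \<open>x'\<^sub>n\<close> by
  \<open>w\<^sub>n = e'\<^sub>n - f\<^sub>0(x'\<^sub>n) \<rightarrow> 0\<close>. Bumps of these heights at the \<open>x'\<^sub>n\<close>, with radii \<open>d(x\<^sub>n, x'\<^sub>n)\<close>, repair this; the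
  radius, positive since \<open>x\<^sub>n \<noteq> x'\<^sub>n\<close>, is just small enough to leave the values at the \<open>x\<^sub>n\<close> unchanged.
\<close>

lemma u_sequence_double_interpolation:
  fixes s s' :: "nat \<Rightarrow> 'a::metric_space \<times> 'b::real_normed_vector"
  assumes u: "u_sequence s" and ne: "\<And>n. fst (s n) \<noteq> fst (s' n)"
    and dx: "(\<lambda>n. dist (fst (s n)) (fst (s' n))) \<longlonglongrightarrow> 0"
    and de: "(\<lambda>n. snd (s n) - snd (s' n)) \<longlonglongrightarrow> 0"
  obtains k :: "nat \<Rightarrow> nat" and f where "strict_mono k" "uniformly_continuous_on UNIV f"
    "\<And>n. f (fst (s (k n))) = snd (s (k n))" "\<And>n. f (fst (s' (k n))) = snd (s' (k n))"
proof -
  obtain r where r: "r > 0" "\<And>n m. n \<noteq> m \<Longrightarrow> r \<le> dist (fst (s n)) (fst (s m))"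
    using u unfolding u_sequence_def separated_seq_iff by auto
  obtain k0 :: "nat \<Rightarrow> nat" and f0 where k0: "strict_mono k0" and f0: "uniformly_continuous_on UNIV f0"
    "\<And>n. f0 (fst (s (k0 n))) = snd (s (k0 n))"
    using u_sequence_interpolation[OF u] by metis
  obtain N where N: "\<And>n. n \<ge> N \<Longrightarrow> dist (fst (s n)) (fst (s' n)) < r / 4"
    using LIMSEQ_D[OF dx, of "r / 4"] r(1) by auto
  define k where "k n = k0 (n + N)" for n
  have k: "strict_mono k"
    using k0 by (simp add: k_def strict_mono_def)
  define p where "p n = fst (s' (k n))" for n
  define \<rho> where "\<rho> n = dist (fst (s (k n))) (p n)" for n
  define w where "w n = snd (s' (k n)) - f0 (p n)" for n
  have \<rho>_pos: "\<rho> n > 0" for n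
    using ne by (simp add: \<rho>_def p_def)
  have \<rho>_le: "\<rho> n < r / 4" for n
    unfolding \<rho>_def p_def
    by (rule N) (use seq_suble[OF k0, of "n + N"] in \<open>simp add: k_def\<close>)
  have sep: "r \<le> dist (fst (s (k n))) (fst (s (k m)))" if "n \<noteq> m" for n m
    using that k by (intro r(2)) (simp add: strict_mono_eq)
  have "\<rho> n + \<rho> m \<le> dist (p n) (p m)" if "n \<noteq> m" for n m
  proof -
    have "r \<le> \<rho> n + dist (p n) (p m) + \<rho> m"
      using sep[OF that] dist_triangle[of "fst (s (k n))" "fst (s (k m))" "p n"]
        dist_triangle[of "p n" "fst (s (k m))" "p m"] by (simp add: \<rho>_def dist_commute)
    then show ?thesis using \<rho>_le[of n] \<rho>_le[of m] by linarith
  qed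
  moreover have "w \<longlonglongrightarrow> 0"
  proof -
    have "(\<lambda>n. f0 (fst (s (k n))) - f0 (p n)) \<longlonglongrightarrow> 0"
      unfolding p_def
      by (rule uniformly_continuous_tendsto[OF f0(1)])
        (use LIMSEQ_subseq_LIMSEQ[OF dx k] in \<open>simp add: o_def\<close>)
    moreover have "(\<lambda>n. snd (s (k n)) - snd (s' (k n))) \<longlonglongrightarrow> 0"
      using LIMSEQ_subseq_LIMSEQ[OF de k] by (simp add: o_def)
    ultimately have "(\<lambda>n. (f0 (fst (s (k n))) - f0 (p n)) - (snd (s (k n)) - snd (s' (k n))))
        \<longlonglongrightarrow> 0 - 0"
      by (rule tendsto_diff)
    moreover have "w = (\<lambda>n. (f0 (fst (s (k n))) - f0 (p n)) - (snd (s (k n)) - snd (s' (k n))))"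
      using f0(2) by (auto simp: w_def k_def)
    ultimately show ?thesis by simp
  qed
  ultimately obtain g where g: "uniformly_continuous_on UNIV g" "\<And>n. g (p n) = w n"
    "\<And>x. (\<And>n. \<rho> n \<le> dist (p n) x) \<Longrightarrow> g x = 0"
    using vanishing_bumps[of \<rho> p w] \<rho>_pos by metis
  have g0: "g (fst (s (k n))) = 0" for n
  proof (rule g(3))
    fix m
    show "\<rho> m \<le> dist (p m) (fst (s (k n)))"
    proof (cases "m = n")
      case False
      then show ?thesis
        using sep[OF False] \<rho>_le[of m] \<rho>_pos[of m]
          dist_triangle[of "fst (s (k m))" "fst (s (k n))" "p m"]
        unfolding \<rho>_def by linarith
    qed (simp add: \<rho>_def dist_commute)
  qed
  show ?thesis
  proof
    show "uniformly_continuous_on UNIV (\<lambda>x. f0 x + g x)"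
      using f0(1) g(1) by (rule uniformly_continuous_on_add)
    show "f0 (fst (s (k n))) + g (fst (s (k n))) = snd (s (k n))" for n
      using g0 f0(2) by (simp add: k_def)
    show "f0 (fst (s' (k n))) + g (fst (s' (k n))) = snd (s' (k n))" for n
      using g(2)[of n] by (simp add: p_def w_def)
  qed (rule k)
qed

section \<open>Necessity\<close>

text \<open>
  A sequence of counterexamples \<open>(x\<^sub>n, e\<^sub>n) \<rightarrow> (x\<^sub>0, e\<^sub>0)\<close> with \<open>x\<^sub>n \<noteq> x\<^sub>0\<close> lies, after thinning out, on the
  graph of a uniformly continuous function through \<open>(x\<^sub>0, e\<^sub>0)\<close>. Thinning makes the distances
  \<open>d(x\<^sub>n, x\<^sub>0)\<close> decrease by the factor \<open>3\<close>, so that the balls around \<open>x\<^sub>n\<close> of half that radius are disjoint.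
\<close>

lemma punctured_continuity:
  fixes \<Xi> :: "'a::metric_space \<times> 'b::real_normed_vector \<Rightarrow> 'c::real_normed_vector"
  assumes S: "superposition \<Xi> ` unif_cont_funs \<subseteq> unif_cont_funs" and "\<eta> > 0"
  shows "\<exists>\<delta>>0. \<forall>x e. x \<noteq> x0 \<longrightarrow> dist x x0 < \<delta> \<longrightarrow> dist e e0 < \<delta> \<longrightarrow>
    dist (\<Xi> (x, e)) (\<Xi> (x0, e0)) < \<eta>"
proof (rule ccontr)
  assume "\<not> ?thesis"
  then have bad: "\<exists>x e. x \<noteq> x0 \<and> dist x x0 < \<delta> \<and> dist e e0 < \<delta> \<and> \<not> dist (\<Xi> (x, e)) (\<Xi> (x0, e0)) < \<eta>"
    if "\<delta> > 0" for \<delta>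
    using that by blast
  have "\<forall>n. \<exists>x e. x \<noteq> x0 \<and> dist x x0 < inverse (real (Suc n)) \<and>
      dist e e0 < inverse (real (Suc n)) \<and> \<not> dist (\<Xi> (x, e)) (\<Xi> (x0, e0)) < \<eta>"
    by (intro allI bad) simp
  then obtain x e where "\<forall>n. x n \<noteq> x0 \<and> dist (x n) x0 < inverse (real (Suc n)) \<and>
      dist (e n) e0 < inverse (real (Suc n)) \<and> \<not> dist (\<Xi> (x n, e n)) (\<Xi> (x0, e0)) < \<eta>"
    unfolding choice_iff by (elim exE)
  then have xe: "\<And>n. x n \<noteq> x0" "\<And>n. dist (x n) x0 < inverse (real (Suc n))"
    "\<And>n. dist (e n) e0 < inverse (real (Suc n))" "\<And>n. \<not> dist (\<Xi> (x n, e n)) (\<Xi> (x0, e0)) < \<eta>"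
    by blast+
  have x: "x \<longlonglongrightarrow> x0"
    by (rule tendsto_dist_iff[THEN iffD2], rule tendsto_sandwich[OF _ _ tendsto_const LIMSEQ_inverse_real_of_nat])
      (auto intro!: always_eventually less_imp_le[OF xe(2)] simp del: of_nat_Suc)
  have e: "e \<longlonglongrightarrow> e0"
    by (rule tendsto_dist_iff[THEN iffD2], rule tendsto_sandwich[OF _ _ tendsto_const LIMSEQ_inverse_real_of_nat])
      (auto intro!: always_eventually less_imp_le[OF xe(3)] simp del: of_nat_Suc)
  have "\<exists>j>N. \<forall>i\<le>N. 3 * dist (x j) x0 \<le> dist (x i) x0" for N
  proof -
    have "\<forall>i\<in>{..N}. eventually (\<lambda>j. dist (x j) x0 < dist (x i) x0 / 3) sequentially"
      using xe(1) by (intro ballI tendstoD[OF x]) simp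
    then have "eventually (\<lambda>j. \<forall>i\<in>{..N}. dist (x j) x0 < dist (x i) x0 / 3) sequentially"
      by (intro eventually_ball_finite) auto
    then have "eventually (\<lambda>j. j > N \<and> (\<forall>i\<in>{..N}. dist (x j) x0 < dist (x i) x0 / 3)) sequentially"
      using eventually_gt_at_top[of N] by (rule eventually_elim2) simp
    then obtain j where "j > N" "\<forall>i\<in>{..N}. dist (x j) x0 < dist (x i) x0 / 3"
      using eventually_happens trivial_limit_sequentially by blast
    then show ?thesis by (intro exI[of _ j]) force
  qed
  from subseq_pairwise[OF this] obtain k :: "nat \<Rightarrow> nat" where
    k: "strict_mono k" "\<And>m n. m < n \<Longrightarrow> 3 * dist (x (k n)) x0 \<le> dist (x (k m)) x0"
    by blast
  define \<rho> where "\<rho> n = dist (x (k n)) x0 / 2" for n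
  have \<rho>_pos: "\<rho> n > 0" for n
    using xe(1) by (simp add: \<rho>_def)
  have less: "\<rho> m + \<rho> n \<le> dist (x (k m)) (x (k n))" if "m < n" for m n
    using k(2)[OF that] dist_triangle[of "x (k m)" x0 "x (k n)"] by (simp add: \<rho>_def)
  have sep: "\<rho> m + \<rho> n \<le> dist (x (k m)) (x (k n))" if "m \<noteq> n" for m n
    using less[of m n] less[of n m] that by (cases m n rule: linorder_cases) (auto simp: dist_commute add.commute)
  have "(\<lambda>n. e (k n) - e0) \<longlonglongrightarrow> 0"
    using LIMSEQ_subseq_LIMSEQ[OF e k(1)] by (simp add: o_def LIM_zero)
  then obtain g where g: "uniformly_continuous_on UNIV g" "\<And>n. g (x (k n)) = e (k n) - e0"
    "\<And>y. (\<And>n. \<rho> n \<le> dist (x (k n)) y) \<Longrightarrow> g y = 0"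
    using vanishing_bumps[of \<rho> "\<lambda>n. x (k n)" "\<lambda>n. e (k n) - e0"] \<rho>_pos sep by metis
  have g0: "g x0 = 0"
    by (rule g(3)) (simp add: \<rho>_def)
  define f where "f y = e0 + g y" for y
  have "uniformly_continuous_on UNIV f"
    unfolding f_def using g(1) by (intro uniformly_continuous_on_add uniformly_continuous_on_const)
  then have "uniformly_continuous_on UNIV (superposition \<Xi> f)"
    using S by (auto simp: unif_cont_funs_def)
  then have "isCont (superposition \<Xi> f) x0"
    using uniformly_continuous_imp_continuous continuous_on_eq_continuous_at open_UNIV by blast
  then have "(\<lambda>n. superposition \<Xi> f (x (k n))) \<longlonglongrightarrow> superposition \<Xi> f x0"
    using LIMSEQ_subseq_LIMSEQ[OF x k(1)] by (auto intro: isCont_tendsto_compose simp: o_def)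
  then have "(\<lambda>n. \<Xi> (x (k n), e (k n))) \<longlonglongrightarrow> \<Xi> (x0, e0)"
    by (simp add: superposition_def f_def g(2) g0)
  then have "eventually (\<lambda>n. dist (\<Xi> (x (k n), e (k n))) (\<Xi> (x0, e0)) < \<eta>) sequentially"
    using \<open>\<eta> > 0\<close> by (rule tendstoD)
  then show False
    using xe(4) by simp
qed

text \<open>
  A function on \<open>X\<close> has a single value at \<open>x\<^sub>0\<close>, so none sees both \<open>\<Xi>(x\<^sub>0, e)\<close> and \<open>\<Xi>(x\<^sub>0, e\<^sub>0)\<close> if
  \<open>e \<noteq> e\<^sub>0\<close>. Hence \<open>\<Xi>(x\<^sub>0, e)\<close> is compared with \<open>\<Xi>(x\<^sub>0, e\<^sub>0)\<close> by way of \<open>\<Xi>(y, e)\<close>, where \<open>y \<noteq> x\<^sub>0\<close> is so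
  close to \<open>x\<^sub>0\<close> that punctured continuity applies at both \<open>(x\<^sub>0, e)\<close> and \<open>(x\<^sub>0, e\<^sub>0)\<close>.
\<close>

lemma superposition_imp_isCont:
  fixes \<Xi> :: "'a::metric_space \<times> 'b::real_normed_vector \<Rightarrow> 'c::real_normed_vector"
  assumes S: "superposition \<Xi> ` unif_cont_funs \<subseteq> unif_cont_funs"
    and x0: "x0 \<in> accumulation_points"
  shows "isCont \<Xi> (x0, e0)"
  unfolding continuous_at_eps_delta
proof (intro allI impI)
  fix \<eta> :: real assume "\<eta> > 0"
  then have \<eta>2: "\<eta> / 2 > 0" by simp
  obtain \<delta> where \<delta>: "\<delta> > 0"
    "\<And>x e. x \<noteq> x0 \<Longrightarrow> dist x x0 < \<delta> \<Longrightarrow> dist e e0 < \<delta> \<Longrightarrow> dist (\<Xi> (x, e)) (\<Xi> (x0, e0)) < \<eta> / 2"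
    using punctured_continuity[OF S \<eta>2, where ?x0.0 = x0 and ?e0.0 = e0] by blast
  have "dist (\<Xi> z) (\<Xi> (x0, e0)) < \<eta>" if z: "dist z (x0, e0) < \<delta>" for z
  proof -
    obtain x e where xe: "z = (x, e)" by (cases z)
    have near: "dist x x0 < \<delta>" "dist e e0 < \<delta>"
      using z dist_fst_le[of z "(x0, e0)"] dist_snd_le[of z "(x0, e0)"] by (auto simp: xe)
    show ?thesis
    proof (cases "x = x0")
      case False
      then show ?thesis
        using \<delta>(2)[OF False near] \<open>\<eta> > 0\<close> by (simp add: xe)
    next
      case True
      obtain \<delta>' where \<delta>': "\<delta>' > 0"
        "\<And>x e'. x \<noteq> x0 \<Longrightarrow> dist x x0 < \<delta>' \<Longrightarrow> dist e' e < \<delta>' \<Longrightarrow> dist (\<Xi> (x, e')) (\<Xi> (x0, e)) < \<eta> / 2"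
        using punctured_continuity[OF S \<eta>2, where ?x0.0 = x0 and ?e0.0 = e] by blast
      have "0 < min \<delta> \<delta>'"
        using \<delta>(1) \<delta>'(1) by simp
      then obtain y where y: "y \<noteq> x0" "dist y x0 < min \<delta> \<delta>'"
        using x0 unfolding accumulation_points_def islimpt_approachable by blast
      have "dist (\<Xi> (y, e)) (\<Xi> (x0, e)) < \<eta> / 2"
        using y \<delta>'(1) by (intro \<delta>'(2)) auto
      moreover have "dist (\<Xi> (y, e)) (\<Xi> (x0, e0)) < \<eta> / 2"
        using y near(2) by (intro \<delta>(2)) auto
      ultimately show ?thesis
        using dist_triangle3[of "\<Xi> (x0, e)" "\<Xi> (x0, e0)" "\<Xi> (y, e)"] True by (simp add: xe)
    qed
  qed
  then show "\<exists>\<delta>>0. \<forall>z. dist z (x0, e0) < \<delta> \<longrightarrow> dist (\<Xi> z) (\<Xi> (x0, e0)) < \<eta>"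
    using \<delta>(1) by blast
qed

lemma not_tendsto_zero_subseq:
  fixes a :: "nat \<Rightarrow> 'b::real_normed_vector"
  assumes "\<not> a \<longlonglongrightarrow> 0"
  obtains k :: "nat \<Rightarrow> nat" and \<delta> where "strict_mono k" "\<delta> > 0" "\<And>n. \<delta> \<le> norm (a (k n))"
proof -
  obtain \<delta> where \<delta>: "\<delta> > 0" "\<And>N. \<exists>n\<ge>N. \<delta> \<le> norm (a n)"
    using assms unfolding LIMSEQ_iff by (auto simp: not_less)
  have "infinite {n. \<delta> \<le> norm (a n)}"
    using \<delta>(2) by (auto simp: infinite_nat_iff_unbounded_le)
  then show ?thesis
    using infinite_enumerate[of "{n. \<delta> \<le> norm (a n)}"] \<delta>(1) that by blast
qed

text \<open>
  If the conclusion fails, it fails by some \<open>\<delta>\<close> along a subsequence, part of which lies, together with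
  its perturbation, on the graph of one uniformly continuous function.
\<close>

lemma superposition_imp_u_continuous:
  fixes \<Xi> :: "'a::metric_space \<times> 'b::real_normed_vector \<Rightarrow> 'c::real_normed_vector"
  assumes S: "superposition \<Xi> ` unif_cont_funs \<subseteq> unif_cont_funs"
  shows "u_continuous \<Xi>"
  unfolding u_continuous_def
proof (intro allI impI)
  fix s s' :: "nat \<Rightarrow> 'a \<times> 'b"
  assume u: "u_sequence s" and ne: "\<forall>n. fst (s n) \<noteq> fst (s' n)"
    and lim: "(\<lambda>n. dist (fst (s n)) (fst (s' n)) + norm (snd (s n) - snd (s' n))) \<longlonglongrightarrow> 0"
  have dx: "(\<lambda>n. dist (fst (s n)) (fst (s' n))) \<longlonglongrightarrow> 0"
    by (rule tendsto_sandwich[OF _ _ tendsto_const lim]) auto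
  have "(\<lambda>n. norm (snd (s n) - snd (s' n))) \<longlonglongrightarrow> 0"
    by (rule tendsto_sandwich[OF _ _ tendsto_const lim]) auto
  then have de: "(\<lambda>n. snd (s n) - snd (s' n)) \<longlonglongrightarrow> 0"
    by (simp add: tendsto_norm_zero_iff)
  show "(\<lambda>n. norm (\<Xi> (s n) - \<Xi> (s' n))) \<longlonglongrightarrow> 0"
  proof (rule ccontr)
    assume "\<not> ?thesis"
    then obtain j :: "nat \<Rightarrow> nat" and \<delta> where j: "strict_mono j" and \<delta>: "\<delta> > 0"
      "\<And>n. \<delta> \<le> norm (\<Xi> (s (j n)) - \<Xi> (s' (j n)))"
      by (rule not_tendsto_zero_subseq) auto
    obtain k :: "nat \<Rightarrow> nat" and f where k: "strict_mono k" and f: "uniformly_continuous_on UNIV f"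
      "\<And>n. f (fst (s (j (k n)))) = snd (s (j (k n)))" "\<And>n. f (fst (s' (j (k n)))) = snd (s' (j (k n)))"
    proof (rule u_sequence_double_interpolation[OF u_sequence_subseq[OF u j]])
      show "fst (s (j n)) \<noteq> fst (s' (j n))" for n
        using ne by simp
      show "(\<lambda>n. dist (fst (s (j n))) (fst (s' (j n)))) \<longlonglongrightarrow> 0"
        using LIMSEQ_subseq_LIMSEQ[OF dx j] by (simp add: o_def)
      show "(\<lambda>n. snd (s (j n)) - snd (s' (j n))) \<longlonglongrightarrow> 0"
        using LIMSEQ_subseq_LIMSEQ[OF de j] by (simp add: o_def)
    qed (rule that)
    have "uniformly_continuous_on UNIV (superposition \<Xi> f)"
      using S f(1) by (auto simp: unif_cont_funs_def)
    moreover have "(\<lambda>n. dist (fst (s (j (k n)))) (fst (s' (j (k n))))) \<longlonglongrightarrow> 0"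
      using LIMSEQ_subseq_LIMSEQ[OF LIMSEQ_subseq_LIMSEQ[OF dx j] k] by (simp add: o_def)
    ultimately have "(\<lambda>n. superposition \<Xi> f (fst (s (j (k n))))
        - superposition \<Xi> f (fst (s' (j (k n))))) \<longlonglongrightarrow> 0"
      by (rule uniformly_continuous_tendsto)
    then have "(\<lambda>n. \<Xi> (s (j (k n))) - \<Xi> (s' (j (k n)))) \<longlonglongrightarrow> 0"
      by (simp add: superposition_def f(2,3))
    then obtain n where "norm (\<Xi> (s (j (k n))) - \<Xi> (s' (j (k n)))) < \<delta>"
      using \<delta>(1) unfolding LIMSEQ_iff by auto
    then show False using \<delta>(2)[of "k n"] by simp
  qed
qed

section \<open>Sufficiency\<close>

lemma isCont_u_continuous_imp_superposition:
  fixes \<Xi> :: "'a::complete_space \<times> 'b::real_normed_vector \<Rightarrow> 'c::real_normed_vector"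
  assumes cont: "\<And>x0 e0. x0 \<in> accumulation_points \<Longrightarrow> isCont \<Xi> (x0, e0)"
    and u: "u_continuous \<Xi>" and f: "uniformly_continuous_on UNIV f"
  shows "uniformly_continuous_on UNIV (superposition \<Xi> f)"
  unfolding uniformly_continuous_on_sequentially
proof (intro allI impI, elim conjE)
  fix x y :: "nat \<Rightarrow> 'a"
  assume lim: "(\<lambda>n. dist (x n) (y n)) \<longlonglongrightarrow> 0"
  define D where "D n = superposition \<Xi> f (x n) - superposition \<Xi> f (y n)" for n
  have "D \<longlonglongrightarrow> 0"
  proof (rule ccontr)
    assume "\<not> D \<longlonglongrightarrow> 0"
    then obtain j :: "nat \<Rightarrow> nat" and \<delta> where j: "strict_mono j" and \<delta>: "\<delta> > 0"
      "\<And>n. \<delta> \<le> norm (D (j n))"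
      by (rule not_tendsto_zero_subseq) blast
    have ne: "x (j n) \<noteq> y (j n)" for n
      using \<delta>(1) \<delta>(2)[of n] by (auto simp: D_def)
    have contra: False if "strict_mono k" and lim0: "(\<lambda>n. D (j (k n))) \<longlonglongrightarrow> 0" for k :: "nat \<Rightarrow> nat"
    proof -
      obtain n where "norm (D (j (k n))) < \<delta>"
        using lim0 \<delta>(1) unfolding LIMSEQ_iff by auto
      then show False using \<delta>(2)[of "k n"] by simp
    qed
    have limk: "(\<lambda>n. dist (x (j (k n))) (y (j (k n)))) \<longlonglongrightarrow> 0" if "strict_mono k" for k :: "nat \<Rightarrow> nat"
      using LIMSEQ_subseq_LIMSEQ[OF LIMSEQ_subseq_LIMSEQ[OF lim j] that] by (simp add: o_def)
    show False
    proof (rule convergent_or_separated_subseq[of "x \<circ> j"])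
      fix l k assume k: "strict_mono k" and l: "(x \<circ> j \<circ> k) \<longlonglongrightarrow> l"
      have xl: "(\<lambda>n. x (j (k n))) \<longlonglongrightarrow> l"
        using l by (simp add: o_def)
      have yl: "(\<lambda>n. y (j (k n))) \<longlonglongrightarrow> l"
      proof (rule tendsto_dist_iff[THEN iffD2], rule tendsto_sandwich[OF _ _ tendsto_const])
        show "(\<lambda>n. dist (x (j (k n))) (y (j (k n))) + dist (x (j (k n))) l) \<longlonglongrightarrow> 0"
          using tendsto_add[OF limk[OF k] xl[THEN tendsto_dist_iff[THEN iffD1]]] by simp
      qed (auto intro!: always_eventually dist_triangle3)
      have "l \<in> accumulation_points"
        unfolding accumulation_points_def islimpt_approachable
      proof (clarsimp)
        fix e :: real assume "e > 0"
        then have "eventually (\<lambda>n. dist (x (j (k n))) l < e \<and> dist (y (j (k n))) l < e) sequentially"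
          using xl yl by (intro eventually_conj tendstoD)
        then obtain n where n: "dist (x (j (k n))) l < e" "dist (y (j (k n))) l < e"
          using eventually_happens trivial_limit_sequentially by blast
        show "\<exists>z. z \<noteq> l \<and> dist z l < e"
          using n ne[of "k n"] by metis
      qed
      then have "isCont \<Xi> (l, f l)" by (rule cont)
      moreover have fl: "isCont f l"
        using f uniformly_continuous_imp_continuous continuous_on_eq_continuous_at open_UNIV by blast
      ultimately have lim': "(\<lambda>n. superposition \<Xi> f (z n)) \<longlonglongrightarrow> superposition \<Xi> f l"
        if "z \<longlonglongrightarrow> l" for z
        unfolding superposition_def
        by (intro isCont_tendsto_compose[of _ \<Xi>] tendsto_Pair that isCont_tendsto_compose[of _ f])
      have "(\<lambda>n. D (j (k n))) \<longlonglongrightarrow> 0"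
        using tendsto_diff[OF lim'[OF xl] lim'[OF yl]] by (simp add: D_def)
      with k show False by (rule contra)
    next
      fix k assume k: "strict_mono k" and sep: "separated_seq (x \<circ> j \<circ> k)"
      define s where "s n = (x (j (k n)), f (x (j (k n))))" for n
      define s' where "s' n = (y (j (k n)), f (y (j (k n))))" for n
      have "u_sequence s"
        using u_sequence_graph[OF f sep] by (simp add: s_def[abs_def] o_def)
      moreover have "fst (s n) \<noteq> fst (s' n)" for n
        using ne by (simp add: s_def s'_def)
      moreover have "(\<lambda>n. dist (fst (s n)) (fst (s' n)) + norm (snd (s n) - snd (s' n))) \<longlonglongrightarrow> 0"
        using tendsto_add[OF limk[OF k] tendsto_norm_zero[OF uniformly_continuous_tendsto[OF f limk[OF k]]]]
        by (simp add: s_def s'_def)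
      ultimately have "(\<lambda>n. norm (\<Xi> (s n) - \<Xi> (s' n))) \<longlonglongrightarrow> 0"
        using u unfolding u_continuous_def by blast
      then have "(\<lambda>n. D (j (k n))) \<longlonglongrightarrow> 0"
        by (simp add: tendsto_norm_zero_iff D_def superposition_def s_def s'_def)
      with k show False by (rule contra)
    qed
  qed
  then have "(\<lambda>n. norm (D n)) \<longlonglongrightarrow> 0"
    by (rule tendsto_norm_zero)
  then show "(\<lambda>n. dist (superposition \<Xi> f (x n)) (superposition \<Xi> f (y n))) \<longlonglongrightarrow> 0"
    by (simp add: D_def dist_norm)
qed

theorem theorem7p6:
  fixes \<Xi> :: "'x::complete_space \<times> 'e::banach \<Rightarrow> 'f::banach"
  shows "superposition \<Xi> ` unif_cont_funs \<subseteq> unif_cont_funs \<longleftrightarrow>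
    (\<forall>x\<^sub>0\<in>accumulation_points. \<forall>e\<^sub>0. isCont \<Xi> (x\<^sub>0, e\<^sub>0)) \<and> u_continuous \<Xi>"
  using superposition_imp_isCont[of \<Xi>] superposition_imp_u_continuous[of \<Xi>]
    isCont_u_continuous_imp_superposition[of \<Xi>]
  unfolding unif_cont_funs_def by blast

end
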